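(* Let $f:\mathbb{R}^d\to\mathbb{R}$ be convex and differentiable, and let $L>0$ be a Lipschitz constant of its gradient, i.e. $\|\nabla f(x)-\nabla f(y)\|\le L\|x-y\|$ for all $x,y\in\mathbb{R}^d$. Let $K\ge 2$, let $x_1,\dots,x_K\in\mathbb{R}^d$ be given (deterministic) points, and let $g_k=\nabla f(x_k)+w_k$ for $k=1,\dots,K$, where $w_1,\dots,w_K$ are independent random vectors, each distributed as $\mathcal{N}(0,\sigma^2 I)$ on $\mathbb{R}^d$ with $\sigma>0$. Write $g=(g_1,\dots,g_K)\in\mathbb{R}^{Kd}$ and $\nabla f=(\nabla f(x_1),\dots,\nabla f(x_K))\in\mathbb{R}^{Kd}$, and let $\hat\theta=(\hat\theta_1,\dots,\hat\theta_K)$ be the COCO estimate computed from $g$ (with points $x_1,\dots,x_K$ and constant $L$). Then $$\operatorname{MSE}(\hat\theta)\le \operatorname{MSE}(g),$$ where $\operatorname{MSE}(\hat\theta)=E\big[\|\hat\theta-\nabla f\|^2\big]$ and $\operatorname{MSE}(g)=E\big[\|g-\nabla f\|^2\big]$.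
   Context: Norms and inner products are Euclidean. Given points $x_1,\dots,x_K\in\mathbb{R}^d$, a constant $L>0$ and vectors $g_1,\dots,g_K\in\mathbb{R}^d$, the COCO estimate $\hat\theta=(\hat\theta_1,\dots,\hat\theta_K)\in\mathbb{R}^{Kd}$ is the (unique) solution of the convex optimization problem $$\underset{\theta_1,\dots,\theta_K\in\mathbb{R}^d}{\text{minimize}}\ \sum_{i=1}^K\|g_i-\theta_i\|^2\quad\text{subject to}\quad \frac1L\|\theta_m-\theta_l\|^2\le\langle\theta_m-\theta_l,\,x_m-x_l\rangle,\quad 1\le m<l\le K.$$ *)

theory Defs
  imports "HOL-Probability.Probability"
begin

text \<open>
  A tuple \<open>(\<theta>\<^sub>1, \<dots>, \<theta>\<^sub>K)\<close> of vectors in \<open>\<real>\<^sup>d\<close> is an element of \<open>real ^ 'd ^ 'k\<close>, with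
  \<open>d = CARD('d)\<close> and \<open>K = CARD('k)\<close>.  The norm of this type is the square root of the sum of the
  squared norms of the blocks, i.e. the Euclidean norm of \<open>\<real>\<^sup>K\<^sup>d\<close>.  The linear order on \<open>'k\<close>
  plays the role of the order on \<open>{1, \<dots>, K}\<close>.
\<close>

definition coco_objective :: "real ^ 'd ^ 'k \<Rightarrow> real ^ 'd ^ 'k \<Rightarrow> real"
  where "coco_objective g \<theta> = (\<Sum>i\<in>UNIV. (norm (g $ i - \<theta> $ i))\<^sup>2)"

definition coco_feasible ::
    "real \<Rightarrow> real ^ 'd ^ 'k::{finite,linorder}
      \<Rightarrow> (real ^ 'd ^ 'k::{finite,linorder}) set"
  where "coco_feasible L x =
    {\<theta>. \<forall>m l. m < l \<longrightarrow>
       1 / L * (norm (\<theta> $ m - \<theta> $ l))\<^sup>2 \<le> (\<theta> $ m - \<theta> $ l) \<bullet> (x $ m - x $ l)}"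

definition coco_estimate ::
    "real \<Rightarrow> real ^ 'd ^ 'k::{finite,linorder} \<Rightarrow> real ^ 'd ^ 'k::{finite,linorder}
      \<Rightarrow> real ^ 'd ^ 'k::{finite,linorder}"
  where "coco_estimate L x g =
    (THE \<theta>. is_arg_min (coco_objective g) (\<lambda>\<theta>. \<theta> \<in> coco_feasible L x) \<theta>)"

text \<open>Density of \<open>\<N>(0, \<sigma>\<^sup>2 I)\<close> on \<open>\<real>\<^sup>d\<close> with respect to Lebesgue measure.\<close>

definition isotropic_normal_density :: "real \<Rightarrow> real ^ 'd \<Rightarrow> real"
  where "isotropic_normal_density \<sigma> v =
    1 / sqrt (2 * pi * \<sigma>\<^sup>2) ^ CARD('d) * exp (- (norm v)\<^sup>2 / (2 * \<sigma>\<^sup>2))"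

text \<open>
  The mean squared error is the expectation of a nonnegative quantity, so it is taken as an
  integral with values in \<open>[0, \<infinity>]\<close>.  (The real-valued Bochner integral would be \<open>0\<close> for a
  non-integrable error.)
\<close>

definition mse :: "'a measure \<Rightarrow> ('a \<Rightarrow> 'b::real_normed_vector) \<Rightarrow> 'b \<Rightarrow> ennreal"
  where "mse M T t = (\<integral>\<^sup>+ \<omega>. ennreal ((norm (T \<omega> - t))\<^sup>2) \<partial>M)"

text \<open>The definite description in \<open>coco_estimate\<close> is proper, and the estimator is measurable.\<close>

lemma coco_objective_eq: "coco_objective g \<theta> = (dist g \<theta>)\<^sup>2"
  by (simp add: coco_objective_def dist_norm norm_vec_def L2_set_def sum_nonneg)

lemma coco_constraint_iff_cball:
  fixes u c :: "real ^ 'd"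
  assumes "L > 0"
  shows "1 / L * (norm u)\<^sup>2 \<le> u \<bullet> c \<longleftrightarrow> u \<in> cball ((L / 2) *\<^sub>R c) (norm ((L / 2) *\<^sub>R c))"
proof -
  have "u \<in> cball ((L / 2) *\<^sub>R c) (norm ((L / 2) *\<^sub>R c))
      \<longleftrightarrow> (norm ((L / 2) *\<^sub>R c - u))\<^sup>2 \<le> (norm ((L / 2) *\<^sub>R c))\<^sup>2"
    unfolding mem_cball dist_norm by (rule power_mono_iff[symmetric]) auto
  also have "\<dots> \<longleftrightarrow> (norm u)\<^sup>2 \<le> L * (u \<bullet> c)"
    unfolding power2_norm_eq_inner by (simp add: algebra_simps inner_commute)
  also have "\<dots> \<longleftrightarrow> 1 / L * (norm u)\<^sup>2 \<le> u \<bullet> c"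
    using assms by (simp add: field_simps)
  finally show ?thesis by simp
qed

lemma coco_feasible_closed_convex:
  fixes x :: "real ^ 'd ^ 'k::{finite,linorder}"
  assumes "L > 0"
  shows "closed (coco_feasible L x)" "convex (coco_feasible L x)" "0 \<in> coco_feasible L x"
proof -
  let ?B = "\<lambda>m l. cball ((L / 2) *\<^sub>R (x $ m - x $ l)) (norm ((L / 2) *\<^sub>R (x $ m - x $ l)))"
  let ?D = "\<lambda>m l (\<theta> :: real ^ 'd ^ 'k::{finite,linorder}). \<theta> $ m - \<theta> $ l"
  have eq: "coco_feasible L x = (\<Inter>(m, l)\<in>{(m, l). m < l}. ?D m l -` ?B m l)"
    unfolding coco_feasible_def coco_constraint_iff_cball[OF assms] by auto
  have "linear (?D m l)" for m l
    by (rule linearI) (auto simp: algebra_simps)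
  then have "convex (?D m l -` ?B m l)" for m l
    by (intro convex_linear_vimage convex_cball)
  then show "convex (coco_feasible L x)"
    unfolding eq by (intro convex_INT) auto
  have "closed (?D m l -` ?B m l)" for m l
    by (intro closed_vimage closed_cball continuous_intros)
  then show "closed (coco_feasible L x)"
    unfolding eq by (intro closed_INT) auto
  show "0 \<in> coco_feasible L x"
    by (simp add: coco_feasible_def)
qed

lemma is_arg_min_coco_iff:
  assumes "L > 0"
  shows "is_arg_min (coco_objective g) (\<lambda>\<theta>. \<theta> \<in> coco_feasible L x) \<theta>
    \<longleftrightarrow> \<theta> = closest_point (coco_feasible L x) g"
proof -
  note S = coco_feasible_closed_convex[OF assms, of x]
  have "is_arg_min (coco_objective g) (\<lambda>\<theta>. \<theta> \<in> coco_feasible L x) \<theta>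
      \<longleftrightarrow> \<theta> \<in> coco_feasible L x \<and> (\<forall>z\<in>coco_feasible L x. dist g \<theta> \<le> dist g z)"
    unfolding is_arg_min_linorder coco_objective_eq by (simp add: power_mono_iff Ball_def)
  also have "\<dots> \<longleftrightarrow> \<theta> = closest_point (coco_feasible L x) g"
    using S closest_point_exists[of "coco_feasible L x" g]
      closest_point_unique[of "coco_feasible L x" \<theta> g] by blast
  finally show ?thesis .
qed

lemma coco_ex1:
  assumes "L > 0"
  shows "\<exists>!\<theta>. is_arg_min (coco_objective g) (\<lambda>\<theta>. \<theta> \<in> coco_feasible L x) \<theta>"
  by (simp add: is_arg_min_coco_iff[OF assms])

lemma borel_measurable_coco_estimate:
  assumes "L > 0"
  shows "coco_estimate L x \<in> borel_measurable borel"
proof -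
  note S = coco_feasible_closed_convex[OF assms, of x]
  have "coco_estimate L x = closest_point (coco_feasible L x)"
    by (rule ext) (simp add: coco_estimate_def is_arg_min_coco_iff[OF assms])
  moreover have "continuous_on UNIV (closest_point (coco_feasible L x))"
    using S by (intro continuous_on_closest_point) auto
  ultimately show ?thesis
    by (simp add: borel_measurable_continuous_onI)
qed

end

theory Submission
  imports Defs
begin

text \<open>
  The bound holds pointwise in the noise.  Gradients of convex \<open>L\<close>-smooth functions are cocoercive
  (Baillon--Haddad), which says precisely that the true gradient tuple is feasible; and the COCO
  estimate is the metric projection of \<open>g\<close> onto the closed convex feasible set, so, as projections
  are nonexpansive, it is at least as close to the feasible point \<open>\<nabla>f\<close> as \<open>g\<close> is.
\<close>

text \<open>Chain rule on a line; it reduces the two estimates that follow to one-variable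
  calculus.\<close>

lemma gderiv_along_line:
  fixes f :: "'a::real_inner \<Rightarrow> real"
  assumes "GDERIV f (z + t *\<^sub>R v) :> D"
  shows "((\<lambda>t. f (z + t *\<^sub>R v)) has_real_derivative D \<bullet> v) (at t)"
proof -
  have line: "((\<lambda>t. z + t *\<^sub>R v) has_derivative (\<lambda>h. h *\<^sub>R v)) (at t)"
    by (auto intro!: derivative_eq_intros)
  have "((\<lambda>t. f (z + t *\<^sub>R v)) has_derivative (\<lambda>h. (h *\<^sub>R v) \<bullet> D)) (at t)"
    using has_derivative_compose[OF line, of f "\<lambda>h. h \<bullet> D"] assms by (simp add: gderiv_def)
  then show ?thesis
    by (simp add: has_field_derivative_def inner_commute mult_commute_abs)
qed

text \<open>Restrict \<open>f\<close> to the line with parameter 0 at \<open>z\<close> and 1 at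
  \<open>y\<close>, and use the tangent inequality for convex functions of one variable.\<close>

lemma convex_on_above_gradient:
  fixes f :: "'a::real_inner \<Rightarrow> real"
  assumes "convex_on UNIV f" and "GDERIV f z :> D"
  shows "f z + D \<bullet> (y - z) \<le> f y"
proof -
  have "convex_on UNIV (\<lambda>t. f (z + t *\<^sub>R (y - z)))"
  proof (rule convex_onI)
    fix t a b :: real
    assume "0 < t" "t < 1"
    moreover have "z + ((1 - t) *\<^sub>R a + t *\<^sub>R b) *\<^sub>R (y - z)
        = (1 - t) *\<^sub>R (z + a *\<^sub>R (y - z)) + t *\<^sub>R (z + b *\<^sub>R (y - z))"
      by (simp add: algebra_simps)
    ultimately show "f (z + ((1 - t) *\<^sub>R a + t *\<^sub>R b) *\<^sub>R (y - z))
        \<le> (1 - t) * f (z + a *\<^sub>R (y - z)) + t * f (z + b *\<^sub>R (y - z))"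
      using convex_onD[OF assms(1), of t "z + a *\<^sub>R (y - z)" "z + b *\<^sub>R (y - z)"] by simp
  qed simp
  from convex_on_imp_above_tangent[OF this, of 0 1 "D \<bullet> (y - z)"] show ?thesis
    using gderiv_along_line[of f z 0 "y - z" D] assms(2) by simp
qed

lemma gradient_lipschitz_imp_quadratic_bound:
  fixes f :: "'a::real_inner \<Rightarrow> real"
  assumes grad: "\<And>y. GDERIV f y :> grad_f y"
    and lip: "\<And>y z. norm (grad_f y - grad_f z) \<le> L * norm (y - z)"
  shows "f y \<le> f z + grad_f z \<bullet> (y - z) + L / 2 * (norm (y - z))\<^sup>2"
proof -
  define v where "v = y - z"
  \<comment> \<open>\<open>h\<close> is \<open>f\<close> along the segment minus the linear and
    quadratic terms of the bound, so \<open>h 1 \<le> h 0\<close> is the claim. Cauchy-Schwarz and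
    the Lipschitz condition make its derivative nonpositive.\<close>
  define h where "h t = f (z + t *\<^sub>R v) - t * (grad_f z \<bullet> v) - L / 2 * t\<^sup>2 * (norm v)\<^sup>2" for t
  have "h 1 \<le> h 0"
  proof (rule DERIV_nonpos_imp_nonincreasing[of 0 1 h])
    fix t :: real
    assume "0 \<le> t" "t \<le> 1"
    have "(grad_f (z + t *\<^sub>R v) - grad_f z) \<bullet> v
        \<le> norm (grad_f (z + t *\<^sub>R v) - grad_f z) * norm v"
      by (rule norm_cauchy_schwarz)
    also have "\<dots> \<le> L * (t * norm v) * norm v"
      using lip[of "z + t *\<^sub>R v" z] \<open>0 \<le> t\<close> by (intro mult_right_mono) auto
    finally have "grad_f (z + t *\<^sub>R v) \<bullet> v - grad_f z \<bullet> v - L * t * (norm v)\<^sup>2 \<le> 0"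
      by (simp add: inner_diff_left power2_eq_square)
    moreover have "(h has_real_derivative
        grad_f (z + t *\<^sub>R v) \<bullet> v - grad_f z \<bullet> v - L * t * (norm v)\<^sup>2) (at t)"
      unfolding h_def by (auto intro!: derivative_eq_intros gderiv_along_line grad)
    ultimately show "\<exists>D. (h has_real_derivative D) (at t) \<and> D \<le> 0"
      by blast
  qed simp
  then show ?thesis
    by (simp add: h_def v_def)
qed

text \<open>A sharpened tangent inequality: at an auxiliary point, the tangent bound from
  \<open>z\<close> is compared with the quadratic upper bound from \<open>y\<close>.\<close>

lemma convex_lipschitz_gradient_lower_bound:
  fixes f :: "'a::real_inner \<Rightarrow> real"
  assumes "convex_on UNIV f" and "\<And>y. GDERIV f y :> grad_f y" and "L > 0"
    and "\<And>y z. norm (grad_f y - grad_f z) \<le> L * norm (y - z)"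
  shows "f z + grad_f z \<bullet> (y - z) + 1 / (2 * L) * (norm (grad_f y - grad_f z))\<^sup>2 \<le> f y"
proof -
  define d where "d = grad_f y - grad_f z"
  \<comment> \<open>One gradient step from \<open>y\<close> for the tilted function \<open>f - \<langle>grad_f z, \<cdot>\<rangle>\<close>, which is minimal at \<open>z\<close>.\<close>
  define p where "p = y - (1 / L) *\<^sub>R d"
  have "f z + grad_f z \<bullet> (p - z) \<le> f p"
    by (intro convex_on_above_gradient assms)
  also have "f p \<le> f y + grad_f y \<bullet> (p - y) + L / 2 * (norm (p - y))\<^sup>2"
    by (intro gradient_lipschitz_imp_quadratic_bound assms)
  also have "L / 2 * (norm (p - y))\<^sup>2 = 1 / (2 * L) * (norm d)\<^sup>2"
    using \<open>L > 0\<close> by (simp add: p_def power2_eq_square)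
  \<comment> \<open>Split \<open>grad_f y = d + grad_f z\<close>. The \<open>d\<close> part
    outweighs the quadratic term and leaves \<open>- 1 / (2 * L) * (norm d)\<^sup>2\<close>; the
    other part turns \<open>p - z\<close> into \<open>y - z\<close>.\<close>
  also have "grad_f y \<bullet> (p - y) = - (1 / L) * (norm d)\<^sup>2 + grad_f z \<bullet> (p - y)"
    by (simp add: p_def d_def power2_norm_eq_inner algebra_simps diff_divide_distrib
        add_divide_distrib)
  finally show ?thesis
    using \<open>L > 0\<close> by (simp add: d_def inner_diff_right field_simps)
qed

text \<open>Add the lower bound to its copy with \<open>y\<close> and \<open>z\<close> exchanged:
  the function values cancel and the two halves of \<open>1 / L\<close> combine.\<close>

lemma gradient_cocoercive:
  fixes f :: "'a::real_inner \<Rightarrow> real"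
  assumes "convex_on UNIV f" and "\<And>y. GDERIV f y :> grad_f y" and "L > 0"
    and "\<And>y z. norm (grad_f y - grad_f z) \<le> L * norm (y - z)"
  shows "1 / L * (norm (grad_f y - grad_f z))\<^sup>2 \<le> (grad_f y - grad_f z) \<bullet> (y - z)"
  using convex_lipschitz_gradient_lower_bound[OF assms, of z y]
    convex_lipschitz_gradient_lower_bound[OF assms, of y z]
  by (simp add: norm_minus_commute[of "grad_f z"] inner_diff_left inner_diff_right field_simps)

lemma dist_coco_estimate_le:
  assumes "L > 0" and "\<theta> \<in> coco_feasible L x"
  shows "dist (coco_estimate L x g) \<theta> \<le> dist g \<theta>"
proof -
  note S = coco_feasible_closed_convex[OF assms(1), of x]
  \<comment> \<open>A feasible \<open>\<theta>\<close> is its own closest point, so nonexpansiveness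
    applied to \<open>g\<close> and \<open>\<theta>\<close> is already the claim.\<close>
  have "dist (closest_point (coco_feasible L x) g) (closest_point (coco_feasible L x) \<theta>) \<le> dist g \<theta>"
    using S by (intro closest_point_lipschitz) auto
  then show ?thesis
    using assms by (simp add: coco_estimate_def is_arg_min_coco_iff closest_point_self)
qed

theorem theorem4p2:
  fixes f :: "real ^ 'd \<Rightarrow> real" and grad_f :: "real ^ 'd \<Rightarrow> real ^ 'd"
    and L \<sigma> :: real
    and x :: "real ^ 'd ^ 'k::{finite,linorder}"
    and M :: "'a measure" and w :: "'k \<Rightarrow> 'a \<Rightarrow> real ^ 'd"
  assumes "convex_on UNIV f"
    and "\<And>y. GDERIV f y :> grad_f y"
    and "L > 0"
    and "\<And>y z. norm (grad_f y - grad_f z) \<le> L * norm (y - z)"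
    and "CARD('k) \<ge> 2"
    and "\<sigma> > 0"
    and "prob_space M"
    and "prob_space.indep_vars M (\<lambda>_. borel) w UNIV"
    and "\<And>k. distributed M lborel (w k) (\<lambda>v. ennreal (isotropic_normal_density \<sigma> v))"
  defines "g \<equiv> \<lambda>\<omega>. \<chi> k. grad_f (x $ k) + w k \<omega>"
    and "G \<equiv> \<chi> k. grad_f (x $ k)"
  shows "mse M (\<lambda>\<omega>. coco_estimate L x (g \<omega>)) G \<le> mse M g G"
proof -
  have "G \<in> coco_feasible L x"
    using gradient_cocoercive[OF assms(1-4)] by (simp add: coco_feasible_def G_def)
  then have "norm (coco_estimate L x (g \<omega>) - G) \<le> norm (g \<omega> - G)" for \<omega>
    using dist_coco_estimate_le[OF \<open>L > 0\<close>] by (simp add: dist_norm)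
  then show ?thesis
    unfolding mse_def by (intro nn_integral_mono ennreal_leI power_mono) auto
qed

end
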